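(* The following properties are satisfied for every convex body $K \subseteq \mathbb{R}^n$. (e) $i(K,\cdot)$ is left-continuous, i.e., for every $\varepsilon > 0$, $$i(K,\varepsilon) = \lim_{\varepsilon' \uparrow \varepsilon} i(K,\varepsilon') = \sup\{i(K,\varepsilon') : 0 < \varepsilon' < \varepsilon\}.$$ (f) $c(K,\cdot)$ is right-continuous, i.e., for every $\varepsilon > 0$, $$c(K,\varepsilon) = \lim_{\varepsilon' \downarrow \varepsilon} c(K,\varepsilon') = \inf\{c(K,\varepsilon') : \varepsilon' > \varepsilon\}.$$
   Context: A convex body $K \subseteq \mathbb{R}^n$ is a compact convex set with nonempty interior; $\|\cdot\|$ is the Euclidean norm and $S^{n-1} = \{x \in \mathbb{R}^n : \|x\| = 1\}$. For $\varepsilon > 0$ define $$c(K,\varepsilon) = \min\{m : \exists r_1,\dots,r_m \in S^{n-1} \ \forall x \in K \ \exists i \ (x + \varepsilon r_i \in \mathrm{int}(K))\},$$ $$i(K,\varepsilon) = \min\{m : \exists r_1,\dots,r_m \in S^{n-1} \ \forall x \in K \ \exists i \ (x + \varepsilon r_i \in K)\},$$ where in each case the value is $\infty$ if no such $m$ exists. Thus $i(K,\cdot)$ and $c(K,\cdot)$ are functions $(0,\infty) \to \mathbb{N} \cup \{\infty\}$; limits, suprema and infima are taken in $\mathbb{N} \cup \{\infty\}$ (with the usual extended-real conventions). *)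

theory Defs
  imports "HOL-Analysis.Analysis"
begin

definition convex_body :: "(real ^ 'n) set \<Rightarrow> bool" where
  "convex_body K \<longleftrightarrow> compact K \<and> convex K \<and> interior K \<noteq> {}"

(* Repetitions among r 0, ..., r (m - 1) are allowed, and values of r outside {..<m} play no role. *)

definition c_admissible :: "(real ^ 'n) set \<Rightarrow> real \<Rightarrow> nat \<Rightarrow> bool" where
  "c_admissible K \<epsilon> m \<longleftrightarrow>
     (\<exists>r :: nat \<Rightarrow> real ^ 'n. (\<forall>i<m. r i \<in> sphere 0 1) \<and>
        (\<forall>x\<in>K. \<exists>i<m. x + \<epsilon> *\<^sub>R r i \<in> interior K))"

definition i_admissible :: "(real ^ 'n) set \<Rightarrow> real \<Rightarrow> nat \<Rightarrow> bool" where
  "i_admissible K \<epsilon> m \<longleftrightarrow>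
     (\<exists>r :: nat \<Rightarrow> real ^ 'n. (\<forall>i<m. r i \<in> sphere 0 1) \<and>
        (\<forall>x\<in>K. \<exists>i<m. x + \<epsilon> *\<^sub>R r i \<in> K))"

(* c_num and i_num are meant for \<epsilon> > 0 only; the values at \<epsilon> \<le> 0 are junk. *)

definition c_num :: "(real ^ 'n) set \<Rightarrow> real \<Rightarrow> enat" where
  "c_num K \<epsilon> = (if \<exists>m. c_admissible K \<epsilon> m then enat (LEAST m. c_admissible K \<epsilon> m) else \<infinity>)"

definition i_num :: "(real ^ 'n) set \<Rightarrow> real \<Rightarrow> enat" where
  "i_num K \<epsilon> = (if \<exists>m. i_admissible K \<epsilon> m then enat (LEAST m. i_admissible K \<epsilon> m) else \<infinity>)"

end

theory Submission
  imports Defs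
begin

text \<open>
  For a fixed number \<open>m\<close> of directions, consider the set of those \<open>\<epsilon> > 0\<close> for which \<open>m\<close> unit vectors
  suffice. If \<open>x\<close> lies in \<open>K\<close> and \<open>x + \<epsilon> r\<close> in the target (\<open>K\<close> itself, or its interior),
  then the whole segment between them, \<open>x\<close> possibly excepted, lies in the target; so this set is an
  initial segment of the positive reals, and both functions are nondecreasing. For a monotone function
  into a complete linear order, a one-sided limit is the supremum or infimum over that side, so
  everything reduces to whether such an initial segment, when proper and nonempty, contains its
  right end point.

  For \<open>i\<close> it does: the unit vectors working for \<open>\<epsilon>\<^sub>k \<rightarrow> \<epsilon>\<close> have a subsequence
  along which all \<open>m\<close> of them converge, and as \<open>K\<close> is closed the limit vectors work for
  \<open>\<epsilon>\<close> (\<open>i_admissible_left_limit\<close>). For \<open>c\<close> it does not: the vectors working for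
  \<open>\<epsilon>\<close> still work for some larger \<open>\<epsilon>'\<close>, because the interior is open and \<open>K\<close> is compact
  (\<open>c_admissible_right_open\<close>).
\<close>

section \<open>One-sided limits of monotone functions\<close>

lemma mono_on_tendsto_at_left_SUP:
  fixes f :: "real \<Rightarrow> 'a :: {complete_linorder, linorder_topology}"
  assumes mono: "mono_on {a<..} f" and "a < x" and sup: "f x = (SUP y\<in>{a<..<x}. f y)"
  shows "(f \<longlongrightarrow> f x) (at_left x)"
proof (rule order_tendstoI)
  fix l assume "l < f x"
  then obtain y where y: "a < y" "y < x" "l < f y"
    unfolding sup less_SUP_iff by auto
  have "l < f z" if "y < z" "z < x" for z
    using mono_onD[OF mono, of y z] y that by (auto intro: less_le_trans)
  then show "\<forall>\<^sub>F z in at_left x. l < f z"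
    using y(2) by (auto simp: eventually_at_left_field)
next
  fix u assume u: "f x < u"
  have "f z < u" if "a < z" "z < x" for z
    using mono_onD[OF mono, of z x] u that by (auto intro: le_less_trans)
  then show "\<forall>\<^sub>F z in at_left x. f z < u"
    using \<open>a < x\<close> by (auto simp: eventually_at_left_field)
qed

lemma mono_on_tendsto_at_right_INF:
  fixes f :: "real \<Rightarrow> 'a :: {complete_linorder, linorder_topology}"
  assumes mono: "mono_on {a<..} f" and "a < x" and inf: "f x = (INF y\<in>{x<..}. f y)"
  shows "(f \<longlongrightarrow> f x) (at_right x)"
proof (rule order_tendstoI)
  fix l assume l: "l < f x"
  have "l < f z" if "x < z" for z
    using mono_onD[OF mono, of x z] l that \<open>a < x\<close> by (auto intro: less_le_trans)
  then show "\<forall>\<^sub>F z in at_right x. l < f z"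
    by (auto simp: eventually_at_right_field intro: exI[of _ "x + 1"])
next
  fix u assume "f x < u"
  then obtain y where y: "x < y" "f y < u"
    unfolding inf INF_less_iff by auto
  have "f z < u" if "x < z" "z < y" for z
    using mono_onD[OF mono, of z y] y that \<open>a < x\<close> by (auto intro: le_less_trans)
  then show "\<forall>\<^sub>F z in at_right x. f z < u"
    using y(1) by (auto simp: eventually_at_right_field)
qed

section \<open>Families of directions moving a set into a target\<close>

text \<open>The targets \<open>T = K\<close> and \<open>T = interior K\<close> give the two admissibility notions, so
  the facts common to both are proved once.\<close>

definition shift_admissible ::
  "('a :: euclidean_space) set \<Rightarrow> 'a set \<Rightarrow> real \<Rightarrow> nat \<Rightarrow> bool" where
  "shift_admissible K T \<epsilon> m \<longleftrightarrow>
     (\<exists>r :: nat \<Rightarrow> 'a. (\<forall>i<m. r i \<in> sphere 0 1) \<and> (\<forall>x\<in>K. \<exists>i<m. x + \<epsilon> *\<^sub>R r i \<in> T))"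

lemma i_admissible_eq_shift: "i_admissible K = shift_admissible K K"
  by (intro ext) (simp add: i_admissible_def shift_admissible_def)

lemma c_admissible_eq_shift: "c_admissible K = shift_admissible K (interior K)"
  by (intro ext) (simp add: c_admissible_def shift_admissible_def)

lemma shift_admissible_mono_card:
  assumes "shift_admissible K T \<epsilon> m" "m \<le> m'"
  shows "shift_admissible K T \<epsilon> m'"
proof -
  obtain r :: "nat \<Rightarrow> 'a" where r: "\<And>i. i < m \<Longrightarrow> r i \<in> sphere 0 1"
      "\<And>x. x \<in> K \<Longrightarrow> \<exists>i<m. x + \<epsilon> *\<^sub>R r i \<in> T"
    using assms(1) unfolding shift_admissible_def by blast
  obtain b :: 'a where b: "b \<in> Basis"
    using nonempty_Basis by blast
  define r' where "r' i = (if i < m then r i else b)" for i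
  have "\<exists>i<m'. x + \<epsilon> *\<^sub>R r' i \<in> T" if "x \<in> K" for x
    using r(2)[OF that] assms(2) by (auto simp: r'_def intro: less_le_trans)
  moreover have "r' i \<in> sphere 0 1" for i
    using r(1)[of i] b by (auto simp: r'_def)
  ultimately show ?thesis
    unfolding shift_admissible_def by blast
qed

lemma shift_admissible_antimono_eps:
  assumes seg: "\<And>x y. x \<in> K \<Longrightarrow> y \<in> T \<Longrightarrow> open_segment x y \<subseteq> T"
    and adm: "shift_admissible K T \<epsilon> m" and eps: "0 < \<epsilon>'" "\<epsilon>' \<le> \<epsilon>"
  shows "shift_admissible K T \<epsilon>' m"
proof -
  obtain r :: "nat \<Rightarrow> 'a" where r: "\<And>i. i < m \<Longrightarrow> r i \<in> sphere 0 1"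
      "\<And>x. x \<in> K \<Longrightarrow> \<exists>i<m. x + \<epsilon> *\<^sub>R r i \<in> T"
    using adm unfolding shift_admissible_def by blast
  have "x + \<epsilon>' *\<^sub>R r i \<in> T" if "x \<in> K" "i < m" "x + \<epsilon> *\<^sub>R r i \<in> T" for x i
  proof (cases "\<epsilon>' = \<epsilon>")
    case False
    have "r i \<noteq> 0"
      using r(1)[OF \<open>i < m\<close>] by auto
    moreover have "x + \<epsilon>' *\<^sub>R r i = (1 - \<epsilon>' / \<epsilon>) *\<^sub>R x + (\<epsilon>' / \<epsilon>) *\<^sub>R (x + \<epsilon> *\<^sub>R r i)"
      using eps by (simp add: algebra_simps)
    ultimately have "x + \<epsilon>' *\<^sub>R r i \<in> open_segment x (x + \<epsilon> *\<^sub>R r i)"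
      using eps False unfolding in_segment by (auto intro!: exI[of _ "\<epsilon>' / \<epsilon>"])
    then show ?thesis
      using seg[OF that(1,3)] by blast
  qed (use that in simp)
  then show ?thesis
    unfolding shift_admissible_def using r by blast
qed

text \<open>A finite family of sequences in a compact set converges along a common subsequence. Only the
  first \<open>m\<close> components matter, so one coordinate is treated per induction step.\<close>

lemma compact_finite_family_subsequence:
  fixes r :: "nat \<Rightarrow> nat \<Rightarrow> 'a :: metric_space"
  assumes "compact S" "\<And>k i. i < m \<Longrightarrow> r k i \<in> S"
  shows "\<exists>s l. strict_mono s \<and> (\<forall>i<m. l i \<in> S \<and> (\<lambda>k. r (s k) i) \<longlonglongrightarrow> l i)"
  using assms(2)
proof (induction m)
  case 0
  then show ?case
    by (auto intro!: exI[of _ id] simp: strict_mono_id)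
next
  case (Suc m)
  have "\<And>k i. i < m \<Longrightarrow> r k i \<in> S"
    using Suc.prems by simp
  from Suc.IH[OF this] obtain s l where s: "strict_mono s"
      and l: "\<And>i. i < m \<Longrightarrow> l i \<in> S \<and> (\<lambda>k. r (s k) i) \<longlonglongrightarrow> l i"
    by blast
  have rm: "\<forall>k. r (s k) m \<in> S"
    using Suc.prems by simp
  obtain p t where t: "p \<in> S" "strict_mono t" "((\<lambda>k. r (s k) m) \<circ> t) \<longlonglongrightarrow> p"
    by (rule seq_compactE[OF \<open>compact S\<close>[unfolded compact_eq_seq_compact_metric] rm])
  have "(l(m := p)) i \<in> S \<and> (\<lambda>k. r ((s \<circ> t) k) i) \<longlonglongrightarrow> (l(m := p)) i" if "i < Suc m" for i
  proof (cases "i = m")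
    case True
    with t show ?thesis
      by (simp add: o_def)
  next
    case False
    with that have "i < m"
      by simp
    with l[OF this] LIMSEQ_subseq_LIMSEQ[OF conjunct2[OF l[OF this]] t(2)] show ?thesis
      by (simp add: o_def)
  qed
  with strict_mono_o[OF s t(2)] show ?case
    by blast
qed

text \<open>The direction that serves a given point \<open>x\<close> may change with \<open>k\<close>, but there are only
  finitely many indices; one that is used infinitely often survives in the limit. Stated
  contrapositively: if every limit point \<open>x + \<epsilon> l\<^sub>i\<close> misses the closed target, then eventually
  so do all \<open>x + \<epsilon>\<^sub>k r\<^sub>k\<^sub>i\<close> at once.\<close>

lemma shift_admissible_limit:
  assumes "closed T" and eps: "\<epsilon> \<longlonglongrightarrow> \<epsilon>0" and adm: "\<And>k. shift_admissible K T (\<epsilon> k) m"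
  shows "shift_admissible K T \<epsilon>0 m"
proof -
  obtain r :: "nat \<Rightarrow> nat \<Rightarrow> 'a" where r: "\<And>k i. i < m \<Longrightarrow> r k i \<in> sphere 0 1"
      "\<And>k x. x \<in> K \<Longrightarrow> \<exists>i<m. x + \<epsilon> k *\<^sub>R r k i \<in> T"
    using adm unfolding shift_admissible_def by metis
  obtain s l where s: "strict_mono s"
      and l: "\<And>i. i < m \<Longrightarrow> l i \<in> sphere 0 1" "\<And>i. i < m \<Longrightarrow> (\<lambda>k. r (s k) i) \<longlonglongrightarrow> l i"
    using compact_finite_family_subsequence[OF compact_sphere, of m r 0 1] r(1) by blast
  have "\<exists>i<m. x + \<epsilon>0 *\<^sub>R l i \<in> T" if "x \<in> K" for x
  proof (rule ccontr)
    assume "\<not> (\<exists>i<m. x + \<epsilon>0 *\<^sub>R l i \<in> T)"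
    moreover have "(\<lambda>k. x + \<epsilon> (s k) *\<^sub>R r (s k) i) \<longlonglongrightarrow> x + \<epsilon>0 *\<^sub>R l i" if "i < m" for i
      using LIMSEQ_subseq_LIMSEQ[OF eps s] l(2)[OF that]
      by (intro tendsto_intros) (auto simp: o_def)
    ultimately have "\<forall>\<^sub>F k in sequentially. x + \<epsilon> (s k) *\<^sub>R r (s k) i \<in> - T" if "i < m" for i
      using that \<open>closed T\<close> by (intro topological_tendstoD) (auto simp: open_Compl)
    then have "\<forall>\<^sub>F k in sequentially. \<forall>i\<in>{..<m}. x + \<epsilon> (s k) *\<^sub>R r (s k) i \<in> - T"
      by (intro eventually_ball_finite) auto
    then obtain k where "\<forall>i<m. x + \<epsilon> (s k) *\<^sub>R r (s k) i \<notin> T"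
      unfolding eventually_sequentially by auto
    then show False
      using r(2)[OF \<open>x \<in> K\<close>] by blast
  qed
  then show ?thesis
    unfolding shift_admissible_def using l(1) by blast
qed

text \<open>The same directions work for a slightly larger \<open>\<epsilon>\<close>: otherwise points of \<open>K\<close> failing for
  \<open>\<epsilon> + 1/k\<close> would accumulate at a point of \<open>K\<close>, and the direction serving that point would serve
  nearby points and nearby shift lengths as well.\<close>

lemma shift_admissible_right_open:
  assumes "compact K" "open T" and adm: "shift_admissible K T \<epsilon> m"
  shows "\<exists>\<epsilon>'>\<epsilon>. shift_admissible K T \<epsilon>' m"
proof -
  obtain r :: "nat \<Rightarrow> 'a" where r: "\<And>i. i < m \<Longrightarrow> r i \<in> sphere 0 1"
      "\<And>x. x \<in> K \<Longrightarrow> \<exists>i<m. x + \<epsilon> *\<^sub>R r i \<in> T"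
    using adm unfolding shift_admissible_def by blast
  define \<delta> where "\<delta> k = \<epsilon> + inverse (real (Suc k))" for k
  have \<delta>_gt: "\<delta> k > \<epsilon>" for k
    by (simp add: \<delta>_def)
  have \<delta>_lim: "\<delta> \<longlonglongrightarrow> \<epsilon>"
    unfolding \<delta>_def by (rule LIMSEQ_inverse_real_of_nat_add)
  have "\<exists>k. \<forall>x\<in>K. \<exists>i<m. x + \<delta> k *\<^sub>R r i \<in> T"
  proof (rule ccontr)
    assume "\<not> (\<exists>k. \<forall>x\<in>K. \<exists>i<m. x + \<delta> k *\<^sub>R r i \<in> T)"
    then obtain x where x: "\<And>k. x k \<in> K" "\<And>k i. i < m \<Longrightarrow> x k + \<delta> k *\<^sub>R r i \<notin> T"
      by metis
    obtain p s where p: "p \<in> K" and s: "strict_mono s" "(x \<circ> s) \<longlonglongrightarrow> p"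
      using \<open>compact K\<close> x(1) unfolding compact_def by blast
    obtain i where i: "i < m" "p + \<epsilon> *\<^sub>R r i \<in> T"
      using r(2)[OF p] by blast
    have "(\<lambda>k. x (s k) + \<delta> (s k) *\<^sub>R r i) \<longlonglongrightarrow> p + \<epsilon> *\<^sub>R r i"
      using LIMSEQ_subseq_LIMSEQ[OF \<delta>_lim s(1)] s(2)
      by (intro tendsto_intros) (auto simp: o_def)
    then have "\<forall>\<^sub>F k in sequentially. x (s k) + \<delta> (s k) *\<^sub>R r i \<in> T"
      using \<open>open T\<close> i(2) by (rule topological_tendstoD)
    then show False
      using x(2)[OF i(1)] by (auto simp: eventually_sequentially)
  qed
  then show ?thesis
    unfolding shift_admissible_def using r(1) \<delta>_gt by blast
qed

section \<open>Convex bodies\<close>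

lemma i_admissible_antimono:
  assumes "convex K" "i_admissible K \<epsilon> m" "0 < \<epsilon>'" "\<epsilon>' \<le> \<epsilon>"
  shows "i_admissible K \<epsilon>' m"
  using assms(1) unfolding i_admissible_eq_shift convex_contains_open_segment
  by (intro shift_admissible_antimono_eps[OF _ assms(2)[unfolded i_admissible_eq_shift] assms(3,4)])
    blast

lemma c_admissible_antimono:
  assumes "convex K" "c_admissible K \<epsilon> m" "0 < \<epsilon>'" "\<epsilon>' \<le> \<epsilon>"
  shows "c_admissible K \<epsilon>' m"
  unfolding c_admissible_eq_shift
proof (rule shift_admissible_antimono_eps[OF _ assms(2)[unfolded c_admissible_eq_shift] assms(3,4)])
  fix x y assume "x \<in> K" "y \<in> interior K"
  then have "open_segment y x \<subseteq> interior K"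
    using closure_subset by (intro in_interior_closure_convex_segment[OF \<open>convex K\<close>]) auto
  then show "open_segment x y \<subseteq> interior K"
    by (subst open_segment_commute)
qed

lemma i_admissible_left_limit:
  assumes "compact K" "0 < \<epsilon>" "\<And>\<epsilon>'. 0 < \<epsilon>' \<Longrightarrow> \<epsilon>' < \<epsilon> \<Longrightarrow> i_admissible K \<epsilon>' m"
  shows "i_admissible K \<epsilon> m"
proof -
  \<comment> \<open>Starting from \<open>inverse 2\<close> instead of \<open>inverse 1\<close> keeps the first term positive.\<close>
  define u where "u k = \<epsilon> * (1 + - inverse (real (Suc (Suc k))))" for k
  have "u \<longlonglongrightarrow> \<epsilon>"
    unfolding u_def by (rule LIMSEQ_Suc[OF LIMSEQ_inverse_real_of_nat_add_minus_mult])
  moreover have "0 < u k" "u k < \<epsilon>" for k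
    using \<open>0 < \<epsilon>\<close> by (simp_all add: u_def field_simps add_pos_nonneg)
  ultimately show ?thesis
    unfolding i_admissible_eq_shift
    using compact_imp_closed[OF \<open>compact K\<close>] assms(3)[unfolded i_admissible_eq_shift]
    by (blast intro: shift_admissible_limit)
qed

lemma c_admissible_right_open:
  assumes "compact K" "c_admissible K \<epsilon> m"
  shows "\<exists>\<epsilon>'>\<epsilon>. c_admissible K \<epsilon>' m"
  using shift_admissible_right_open[of K "interior K" \<epsilon> m] assms
  by (simp add: c_admissible_eq_shift)

text \<open>Surplus directions may be added freely, so a bound on the minimal number is the same as
  admissibility of that bound. This turns all statements about the two functions into statements
  about admissibility for a fixed number of directions.\<close>

lemma least_enat_le_iff:
  fixes P :: "nat \<Rightarrow> bool"
  assumes "\<And>a b. P a \<Longrightarrow> a \<le> b \<Longrightarrow> P b"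
  shows "(if \<exists>k. P k then enat (LEAST k. P k) else \<infinity>) \<le> enat m \<longleftrightarrow> P m"
  using assms by (auto intro: Least_le LeastI)

lemma i_num_le_iff: "i_num K \<epsilon> \<le> enat m \<longleftrightarrow> i_admissible K \<epsilon> m"
  unfolding i_num_def
  by (rule least_enat_le_iff) (auto simp: i_admissible_eq_shift intro: shift_admissible_mono_card)

lemma c_num_le_iff: "c_num K \<epsilon> \<le> enat m \<longleftrightarrow> c_admissible K \<epsilon> m"
  unfolding c_num_def
  by (rule least_enat_le_iff) (auto simp: c_admissible_eq_shift intro: shift_admissible_mono_card)

lemma enat_le_if_finite_bounds:
  fixes x y :: enat
  assumes "\<And>m. y \<le> enat m \<Longrightarrow> x \<le> enat m"
  shows "x \<le> y"
  using assms by (cases y) auto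

lemma mono_on_i_num: "convex K \<Longrightarrow> mono_on {0<..} (i_num K)"
  by (rule mono_onI, rule enat_le_if_finite_bounds, unfold i_num_le_iff greaterThan_iff)
    (erule (3) i_admissible_antimono)

lemma mono_on_c_num: "convex K \<Longrightarrow> mono_on {0<..} (c_num K)"
  by (rule mono_onI, rule enat_le_if_finite_bounds, unfold c_num_le_iff greaterThan_iff)
    (erule (3) c_admissible_antimono)

lemma i_num_eq_SUP:
  assumes "compact K" "convex K" "0 < \<epsilon>"
  shows "i_num K \<epsilon> = (SUP \<epsilon>'\<in>{0<..<\<epsilon>}. i_num K \<epsilon>')"
proof (rule antisym)
  show "i_num K \<epsilon> \<le> (SUP \<epsilon>'\<in>{0<..<\<epsilon>}. i_num K \<epsilon>')"
    by (rule enat_le_if_finite_bounds, unfold SUP_le_iff i_num_le_iff)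
      (rule i_admissible_left_limit[OF assms(1,3)], simp)
  show "(SUP \<epsilon>'\<in>{0<..<\<epsilon>}. i_num K \<epsilon>') \<le> i_num K \<epsilon>"
    by (rule SUP_least, rule mono_onD[OF mono_on_i_num[OF \<open>convex K\<close>]]) auto
qed

lemma c_num_eq_INF:
  assumes "compact K" "convex K" "0 < \<epsilon>"
  shows "c_num K \<epsilon> = (INF \<epsilon>'\<in>{\<epsilon><..}. c_num K \<epsilon>')"
proof (rule antisym)
  show "c_num K \<epsilon> \<le> (INF \<epsilon>'\<in>{\<epsilon><..}. c_num K \<epsilon>')"
    using \<open>0 < \<epsilon>\<close> by (intro INF_greatest, intro mono_onD[OF mono_on_c_num[OF \<open>convex K\<close>]]) auto
  show "(INF \<epsilon>'\<in>{\<epsilon><..}. c_num K \<epsilon>') \<le> c_num K \<epsilon>"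
  proof (rule enat_le_if_finite_bounds)
    fix m assume "c_num K \<epsilon> \<le> enat m"
    then obtain \<epsilon>' where "\<epsilon>' > \<epsilon>" "c_num K \<epsilon>' \<le> enat m"
      using c_admissible_right_open[OF \<open>compact K\<close>] unfolding c_num_le_iff by blast
    then show "(INF \<epsilon>'\<in>{\<epsilon><..}. c_num K \<epsilon>') \<le> enat m"
      by (intro INF_lower2[of \<epsilon>']) auto
  qed
qed

theorem theorem4p2:
  fixes K :: "(real ^ 'n) set"
  assumes "convex_body K"
  shows "(\<forall>\<epsilon>>0. (i_num K \<longlongrightarrow> i_num K \<epsilon>) (at_left \<epsilon>)
                \<and> i_num K \<epsilon> = (SUP \<epsilon>'\<in>{0<..<\<epsilon>}. i_num K \<epsilon>'))
       \<and> (\<forall>\<epsilon>>0. (c_num K \<longlongrightarrow> c_num K \<epsilon>) (at_right \<epsilon>)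
                \<and> c_num K \<epsilon> = (INF \<epsilon>'\<in>{\<epsilon><..}. c_num K \<epsilon>'))"
proof -
  have K: "compact K" "convex K"
    using assms by (auto simp: convex_body_def)
  show ?thesis
    using mono_on_tendsto_at_left_SUP[OF mono_on_i_num[OF K(2)] _ i_num_eq_SUP[OF K]]
      mono_on_tendsto_at_right_INF[OF mono_on_c_num[OF K(2)] _ c_num_eq_INF[OF K]]
      i_num_eq_SUP[OF K] c_num_eq_INF[OF K]
    by blast
qed

end
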